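(* For any $r\in(0,1]$, the set $\mathbb{K}_d(r)$ is compact in $\mathbb{X}_d$.
   Context: A convex domain in $\mathbb{C}^d$ is $\mathbb{C}$-properly convex if it contains no entire complex affine line. $\mathbb{X}_d$ is the set of all non-empty $\mathbb{C}$-properly convex domains in $\mathbb{C}^d$, with the local Hausdorff topology: $\Omega_n\to\Omega$ in $\mathbb{X}_d$ if there is $R_0\ge0$ such that for all $R\ge R_0$ the Hausdorff distance between $\overline{\Omega}_n\cap\overline{B(0;R)}$ and $\overline{\Omega}\cap\overline{B(0;R)}$ tends to $0$, where $B(0;R)$ is the Euclidean ball (the Hausdorff distance between the empty set and a non-empty set is $\infty$). With $e_1,\dots,e_d$ the standard basis of $\mathbb{C}^d$ and $\mathbb{D}\subset\mathbb{C}$ the open unit disk, for $r\in(0,1]$ the set $\mathbb{K}_d(r)\subset\mathbb{X}_d$ consists of the $\mathbb{C}$-properly convex domains $\Omega\subset\mathbb{C}^d$ such that (i) $r\mathbb{D}\cdot e_1\subset\Omega$ and $\mathbb{D}\cdot e_j\subset\Omega$ for $j=2,\dots,d$; and (ii) for every $j=1,\dots,d$, $e_j\in\partial\Omega$ and $(e_j+\mathrm{Span}_{\mathbb{C}}\{e_{j+1},\dots,e_d\})\cap\Omega=\emptyset$. *)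

theory Defs
  imports "HOL-Analysis.Analysis"
begin

text \<open>
  Complex \<open>d\<close>-space is \<^typ>\<open>complex ^ 'd\<close> with \<open>d = CARD('d)\<close>. The set \<open>K_d(r)\<close> below refers to the order of
  the standard basis, so its index type also carries a linear order; a finite linear order is
  isomorphic to \<open>1 < \<dots> < d\<close>, with \<open>Min UNIV\<close> in the role of \<open>1\<close>.
\<close>

definition complex_affine_line :: "(complex ^ 'd) set \<Rightarrow> bool" where
  "complex_affine_line L \<longleftrightarrow> (\<exists>a b. b \<noteq> 0 \<and> L = range (\<lambda>z. a + z *s b))"

definition C_properly_convex :: "(complex ^ 'd) set \<Rightarrow> bool" where
  "C_properly_convex \<Omega> \<longleftrightarrow> convex \<Omega> \<and> \<not> (\<exists>L. complex_affine_line L \<and> L \<subseteq> \<Omega>)"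

text \<open>Connectedness of a domain is implied by convexity.\<close>

definition X_space :: "(complex ^ 'd) set set" where
  "X_space = {\<Omega>. open \<Omega> \<and> \<Omega> \<noteq> {} \<and> C_properly_convex \<Omega>}"

text \<open>
  In \<^typ>\<open>ennreal\<close> the infimum over the empty set is \<open>\<infinity>\<close> and the supremum over it is \<open>0\<close>, so the
  distance between the empty set and a non-empty set is \<open>\<infinity>\<close>, and that of the empty set to itself is \<open>0\<close>.
\<close>

definition hausdorff_distance :: "'a::metric_space set \<Rightarrow> 'a set \<Rightarrow> ennreal" where
  "hausdorff_distance A B =
     max (SUP a\<in>A. INF b\<in>B. ennreal (dist a b)) (SUP b\<in>B. INF a\<in>A. ennreal (dist a b))"

definition local_hausdorff_converges ::
    "(nat \<Rightarrow> (complex ^ 'd) set) \<Rightarrow> (complex ^ 'd) set \<Rightarrow> bool" where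
  "local_hausdorff_converges S \<Omega> \<longleftrightarrow>
     (\<exists>R0\<ge>0. \<forall>R\<ge>R0.
        (\<lambda>n. hausdorff_distance (closure (S n) \<inter> closure (ball 0 R)) (closure \<Omega> \<inter> closure (ball 0 R)))
          \<longlonglongrightarrow> 0)"

text \<open>
  The topology determined by this convergence: a set is open iff every sequence converging to
  one of its points is eventually inside it (equivalently, closed sets are the sequentially closed ones).
\<close>

definition local_hausdorff_open :: "(complex ^ 'd) set set \<Rightarrow> bool" where
  "local_hausdorff_open U \<longleftrightarrow> U \<subseteq> X_space \<and>
     (\<forall>S \<Omega>. range S \<subseteq> X_space \<longrightarrow> \<Omega> \<in> U \<longrightarrow> local_hausdorff_converges S \<Omega> \<longrightarrow>
        (\<forall>\<^sub>F n in sequentially. S n \<in> U))"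

definition local_hausdorff_topology :: "(complex ^ 'd) set topology" where
  "local_hausdorff_topology = topology local_hausdorff_open"

lemma istopology_local_hausdorff_open: "istopology local_hausdorff_open"
  unfolding istopology_def
proof (intro conjI allI impI)
  fix U V :: "(complex ^ 'd) set set"
  assume "local_hausdorff_open U" "local_hausdorff_open V"
  then show "local_hausdorff_open (U \<inter> V)"
    unfolding local_hausdorff_open_def by (auto intro: eventually_conj)
next
  fix \<U> :: "(complex ^ 'd) set set set"
  assume *: "\<forall>U\<in>\<U>. local_hausdorff_open U"
  have "\<forall>\<^sub>F n in sequentially. S n \<in> \<Union>\<U>"
    if S: "range S \<subseteq> X_space" "\<Omega> \<in> \<Union>\<U>" "local_hausdorff_converges S \<Omega>" for S \<Omega>
  proof -
    obtain U where U: "U \<in> \<U>" "\<Omega> \<in> U" using S(2) by blast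
    then have "\<forall>\<^sub>F n in sequentially. S n \<in> U"
      using * S unfolding local_hausdorff_open_def by blast
    then show ?thesis by eventually_elim (use U in blast)
  qed
  moreover have "\<Union>\<U> \<subseteq> X_space"
    using * unfolding local_hausdorff_open_def by blast
  ultimately show "local_hausdorff_open (\<Union>\<U>)"
    unfolding local_hausdorff_open_def by blast
qed

lemma openin_local_hausdorff_topology:
  "openin local_hausdorff_topology U \<longleftrightarrow> local_hausdorff_open U"
  by (simp add: local_hausdorff_topology_def topology_inverse' istopology_local_hausdorff_open)

lemma topspace_local_hausdorff_topology:
  "topspace local_hausdorff_topology = X_space"
proof -
  have "local_hausdorff_open X_space"
    unfolding local_hausdorff_open_def by (auto intro: always_eventually)
  then show ?thesis
    unfolding topspace_def openin_local_hausdorff_topology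
    by (auto simp: local_hausdorff_open_def)
qed

definition std_basis :: "'d \<Rightarrow> complex ^ 'd" where
  "std_basis j = axis j 1"

definition K_set :: "real \<Rightarrow> (complex ^ 'd::{finite,linorder}) set set" where
  "K_set r = {\<Omega> \<in> X_space.
     {(of_real r * z) *s std_basis (Min UNIV) | z. z \<in> ball 0 1} \<subseteq> \<Omega> \<and>
     (\<forall>j. j \<noteq> Min UNIV \<longrightarrow> {z *s std_basis j | z. z \<in> ball 0 1} \<subseteq> \<Omega>) \<and>
     (\<forall>j. std_basis j \<in> frontier \<Omega> \<and>
          (\<lambda>v. std_basis j + v) ` vec.span {std_basis k | k. j < k} \<inter> \<Omega> = {})}"

end

theory Submission
  imports Defs
begin

text \<open>
  A domain is encoded by the values of its distance function on a countable dense set, which maps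
  \<open>K_d(r)\<close> into a compact product of intervals. The image is closed: the zero set of the limiting
  distance function is convex, and its interior is the limit domain. Pointwise convergence of
  distance functions of convex sets containing \<open>0\<close> implies local Hausdorff convergence, since a
  nearby point slightly outside the ball can be pulled back towards \<open>0\<close> inside the set. Finally, a
  convex domain containing \<open>0\<close> and a complex line contains the direction vector of that line, which
  after scaling lies in some \<open>e_j + Span {e_{j+1}, \<dots>, e_d}\<close>; hence no limit contains a line.
\<close>

section \<open>Limits of distance functions\<close>

lemma ex_dense_sequence:
  obtains q :: "nat \<Rightarrow> 'a::second_countable_topology" where "closure (range q) = UNIV"
proof -
  obtain D :: "'a set" where D: "countable D" "\<And>X. open X \<Longrightarrow> X \<noteq> {} \<Longrightarrow> \<exists>d\<in>D. d \<in> X"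
    by (rule countable_dense_setE) blast
  have "D \<noteq> {}" using D(2)[of UNIV] by auto
  then have "range (from_nat_into D) = D" using D(1) by simp
  moreover have "closure D = UNIV"
    using D(2)[of "- closure D"] closure_subset[of D] by auto
  ultimately show ?thesis using that by metis
qed

lemma dense_sequence_approx:
  fixes q :: "'i \<Rightarrow> 'a::metric_space"
  assumes "closure (range q) = UNIV" "e > 0"
  obtains k where "dist (q k) x < e"
proof -
  have "x \<in> closure (range q)" using assms by simp
  then obtain y where "y \<in> range q" "dist y x < e"
    using assms(2) unfolding closure_approachable by blast
  then show ?thesis using that by blast
qed

lemma infdist_closure: "infdist x (closure A) = infdist x A"
  by (simp add: infdist_eq_setdist)

lemma infdist_attained:
  fixes A :: "'a::heine_borel set"
  assumes "A \<noteq> {}"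
  obtains y where "y \<in> closure A" "infdist x A = dist x y"
proof -
  obtain y where y: "y \<in> closure A" "\<And>z. z \<in> closure A \<Longrightarrow> dist x y \<le> dist x z"
    using distance_attains_inf[of "closure A" x] assms by auto
  have "infdist x (closure A) = dist x y"
  proof (rule antisym)
    show "infdist x (closure A) \<le> dist x y" using y(1) by (rule infdist_le)
    show "dist x y \<le> infdist x (closure A)"
      using assms y(2) by (subst infdist_notempty) (auto intro: cINF_greatest)
  qed
  then show ?thesis using that y(1) by (simp add: infdist_closure)
qed

lemma infdist_convex_combination_le:
  fixes A :: "'a::euclidean_space set"
  assumes "convex A" "u \<ge> 0" "v \<ge> 0" "u + v = 1"
  shows "infdist (u *\<^sub>R x + v *\<^sub>R y) A \<le> u * infdist x A + v * infdist y A"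
proof (cases "A = {}")
  case False
  obtain x' where x': "x' \<in> closure A" "infdist x A = dist x x'" using infdist_attained False .
  obtain y' where y': "y' \<in> closure A" "infdist y A = dist y y'" using infdist_attained False .
  have "u *\<^sub>R x' + v *\<^sub>R y' \<in> closure A"
    using convex_closure[OF assms(1)] x' y' assms by (simp add: convexD)
  then have "infdist (u *\<^sub>R x + v *\<^sub>R y) A \<le> dist (u *\<^sub>R x + v *\<^sub>R y) (u *\<^sub>R x' + v *\<^sub>R y')"
    using infdist_le infdist_closure by metis
  also have "\<dots> = norm (u *\<^sub>R (x - x') + v *\<^sub>R (y - y'))"
    by (simp add: dist_norm algebra_simps)
  also have "\<dots> \<le> u * norm (x - x') + v * norm (y - y')"
    using assms norm_triangle_ineq[of "u *\<^sub>R (x - x')" "v *\<^sub>R (y - y')"] by simp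
  finally show ?thesis using x' y' by (simp add: dist_norm)
qed (simp add: infdist_def)

lemma uniform_infdist_convergence:
  fixes S :: "nat \<Rightarrow> 'a::metric_space set"
  assumes dense: "closure (range q) = UNIV"
    and lim: "\<And>k. (\<lambda>n. infdist (q k) (S n)) \<longlonglongrightarrow> infdist (q k) A"
    and "compact B" "e > 0"
  shows "\<forall>\<^sub>F n in sequentially. \<forall>x\<in>B. \<bar>infdist x (S n) - infdist x A\<bar> < e"
proof -
  have "B \<subseteq> (\<Union>k\<in>UNIV. ball (q k) (e / 3))"
  proof
    fix x
    obtain k where "dist (q k) x < e / 3"
      using dense_sequence_approx[OF dense, of "e / 3" x] \<open>e > 0\<close> by auto
    then show "x \<in> (\<Union>k\<in>UNIV. ball (q k) (e / 3))" by auto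
  qed
  then obtain N where N: "finite N" "B \<subseteq> (\<Union>k\<in>N. ball (q k) (e / 3))"
    using compactE_image[OF \<open>compact B\<close>, of UNIV "\<lambda>k. ball (q k) (e / 3)"] by auto
  have "\<forall>\<^sub>F n in sequentially. \<forall>k\<in>N. \<bar>infdist (q k) (S n) - infdist (q k) A\<bar> < e / 3"
  proof (rule eventually_ball_finite[OF N(1)], rule ballI)
    fix k
    show "\<forall>\<^sub>F n in sequentially. \<bar>infdist (q k) (S n) - infdist (q k) A\<bar> < e / 3"
      using tendstoD[OF lim[of k], of "e / 3"] \<open>e > 0\<close> by (simp add: dist_real_def)
  qed
  then show ?thesis
  proof eventually_elim
    case (elim n)
    show ?case
    proof
      fix x assume "x \<in> B"
      then obtain k where k: "k \<in> N" "dist (q k) x < e / 3" using N(2) by auto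
      have "\<bar>infdist (q k) (S n) - infdist x (S n)\<bar> \<le> dist (q k) x"
        and "\<bar>infdist (q k) A - infdist x A\<bar> \<le> dist (q k) x"
        by (rule infdist_triangle_abs)+
      moreover have "\<bar>infdist (q k) (S n) - infdist (q k) A\<bar> < e / 3" using elim k(1) by blast
      ultimately show "\<bar>infdist x (S n) - infdist x A\<bar> < e" using k(2) by linarith
    qed
  qed
qed

lemma infdist_convergent_from_dense:
  fixes S :: "nat \<Rightarrow> 'a::metric_space set"
  assumes dense: "closure (range q) = UNIV"
    and lim: "\<And>k. convergent (\<lambda>n. infdist (q k) (S n))"
  shows "convergent (\<lambda>n. infdist x (S n))"
proof (rule Cauchy_convergent, rule metric_CauchyI)
  fix e :: real assume "e > 0"
  obtain k where k: "dist (q k) x < e / 3"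
    using dense_sequence_approx[OF dense, of "e / 3" x] \<open>e > 0\<close> by auto
  obtain M where M: "\<And>m n. m \<ge> M \<Longrightarrow> n \<ge> M \<Longrightarrow> dist (infdist (q k) (S m)) (infdist (q k) (S n)) < e / 3"
    using metric_CauchyD[OF convergent_Cauchy[OF lim[of k]], of "e / 3"] \<open>e > 0\<close> by auto
  have "dist (infdist x (S m)) (infdist x (S n)) < e" if "m \<ge> M" "n \<ge> M" for m n
    using M[OF that] k infdist_triangle_abs[of "q k" "S m" x] infdist_triangle_abs[of "q k" "S n" x]
    unfolding dist_real_def by linarith
  then show "\<exists>M. \<forall>m\<ge>M. \<forall>n\<ge>M. dist (infdist x (S m)) (infdist x (S n)) < e" by blast
qed

lemma infdist_limit_zero_set:
  fixes S :: "nat \<Rightarrow> 'a::heine_borel set"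
  assumes lim: "\<And>x. (\<lambda>n. infdist x (S n)) \<longlonglongrightarrow> f x"
    and ne: "\<And>n. S n \<noteq> {}"
  shows "f x = infdist x {y. f y = 0}" and "closed {y. f y = 0}"
proof -
  have lip: "\<bar>f x - f y\<bar> \<le> dist x y" for x y
  proof (rule LIMSEQ_le_const2)
    show "(\<lambda>n. \<bar>infdist x (S n) - infdist y (S n)\<bar>) \<longlonglongrightarrow> \<bar>f x - f y\<bar>"
      by (intro tendsto_intros lim)
    show "\<exists>N. \<forall>n\<ge>N. \<bar>infdist x (S n) - infdist y (S n)\<bar> \<le> dist x y"
      using infdist_triangle_abs by blast
  qed
  have "continuous_on UNIV f"
    unfolding continuous_on_iff using lip
    by (auto simp: dist_real_def) (metis dist_commute le_less_trans)
  then show "closed {y. f y = 0}"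
    by (simp add: closed_Collect_eq)
  have "\<forall>n. \<exists>y. y \<in> closure (S n) \<and> infdist x (S n) = dist x y"
    using infdist_attained[OF ne] by metis
  then obtain y where y: "\<And>n. y n \<in> closure (S n)" "\<And>n. infdist x (S n) = dist x (y n)"
    by metis
  have "bounded (range (\<lambda>n. infdist x (S n)))"
    using lim convergent_imp_bounded by blast
  then obtain b where "\<And>n. dist x (y n) \<le> b"
    by (auto simp: bounded_iff y(2))
  then have "bounded (range y)" unfolding bounded_def by blast
  then obtain l \<rho> where l: "strict_mono (\<rho> :: nat \<Rightarrow> nat)" "(y \<circ> \<rho>) \<longlonglongrightarrow> l"
    using bounded_imp_convergent_subsequence by blast
  have "(\<lambda>n. dist l ((y \<circ> \<rho>) n)) \<longlonglongrightarrow> dist l l" by (intro tendsto_intros l)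
  then have "(\<lambda>n. dist l ((y \<circ> \<rho>) n)) \<longlonglongrightarrow> 0" by simp
  moreover have le: "norm (infdist l (S (\<rho> n))) \<le> dist l ((y \<circ> \<rho>) n)" for n
    using infdist_le[OF y(1)[of "\<rho> n"], of l] by (simp add: infdist_closure infdist_nonneg)
  ultimately have "(\<lambda>n. infdist l (S (\<rho> n))) \<longlonglongrightarrow> 0"
    by (intro Lim_null_comparison[OF always_eventually[OF allI[OF le]]])
  moreover have "(\<lambda>n. infdist l (S (\<rho> n))) \<longlonglongrightarrow> f l"
    using LIMSEQ_subseq_LIMSEQ[OF lim l(1)] by (simp add: o_def)
  ultimately have fl: "f l = 0" using LIMSEQ_unique by blast
  have "(\<lambda>n. dist x ((y \<circ> \<rho>) n)) \<longlonglongrightarrow> dist x l" by (intro tendsto_intros l)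
  moreover have "(\<lambda>n. dist x ((y \<circ> \<rho>) n)) \<longlonglongrightarrow> f x"
    using LIMSEQ_subseq_LIMSEQ[OF lim l(1)] by (simp add: o_def y(2)[symmetric])
  ultimately have fx: "f x = dist x l" using LIMSEQ_unique by blast
  show "f x = infdist x {y. f y = 0}"
  proof (rule antisym)
    show "infdist x {y. f y = 0} \<le> f x" using fl fx by (auto intro: infdist_le)
    have "f x \<le> dist x z" if "f z = 0" for z using lip[of x z] that by simp
    then show "f x \<le> infdist x {y. f y = 0}"
      using fl by (subst infdist_notempty) (auto intro: cINF_greatest)
  qed
qed

lemma infdist_limit_zero_set_convex:
  fixes S :: "nat \<Rightarrow> 'a::euclidean_space set"
  assumes lim: "\<And>x. (\<lambda>n. infdist x (S n)) \<longlonglongrightarrow> f x"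
    and conv: "\<And>n. convex (S n)"
  shows "convex {y. f y = 0}"
proof (rule convexI, clarify)
  fix x y u v assume *: "f x = 0" "f y = 0" "u \<ge> 0" "v \<ge> 0" "u + v = (1::real)"
  have "f (u *\<^sub>R x + v *\<^sub>R y) \<le> u * f x + v * f y"
  proof (rule LIMSEQ_le[OF lim])
    show "(\<lambda>n. u * infdist x (S n) + v * infdist y (S n)) \<longlonglongrightarrow> u * f x + v * f y"
      by (intro tendsto_intros lim)
  qed (use infdist_convex_combination_le[OF conv] * in blast)
  moreover have "f (u *\<^sub>R x + v *\<^sub>R y) \<ge> 0"
    by (rule LIMSEQ_le_const[OF lim]) (simp add: infdist_nonneg)
  ultimately show "f (u *\<^sub>R x + v *\<^sub>R y) = 0" using * by simp
qed

lemma interior_limit_eventually_in: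
  fixes S :: "nat \<Rightarrow> 'a::euclidean_space set"
  assumes lim: "\<And>x. (\<lambda>n. infdist x (S n)) \<longlonglongrightarrow> f x"
    and conv: "\<And>n. convex (S n)" and ne: "\<And>n. S n \<noteq> {}"
    and x: "x \<in> interior {y. f y = 0}"
  shows "\<forall>\<^sub>F n in sequentially. x \<in> S n"
proof -
  obtain e where e: "e > 0" "cball x e \<subseteq> {y. f y = 0}"
    using x by (auto simp: mem_interior_cball)
  obtain q :: "nat \<Rightarrow> 'a" where q: "closure (range q) = UNIV" by (rule ex_dense_sequence)
  have fA: "f z = infdist z {y. f y = 0}" for z by (rule infdist_limit_zero_set(1)[OF lim ne])
  have "\<forall>\<^sub>F n in sequentially. \<forall>z\<in>cball x e. \<bar>infdist z (S n) - infdist z {y. f y = 0}\<bar> < e"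
  proof (rule uniform_infdist_convergence[OF q])
    show "(\<lambda>n. infdist (q k) (S n)) \<longlonglongrightarrow> infdist (q k) {y. f y = 0}" for k
      using lim[of "q k"] fA[of "q k"] by simp
  qed (use e in auto)
  then show ?thesis
  proof eventually_elim
    case (elim n)
    show ?case
    proof (rule ccontr)
      assume "x \<notin> S n"
      then obtain a b where a: "a \<noteq> 0" "a \<bullet> x \<le> b" "\<And>y. y \<in> S n \<Longrightarrow> b \<le> a \<bullet> y"
        using separating_hyperplane_sets[of "{x}" "S n"] conv ne by auto
      define z where "z = x - (e / norm a) *\<^sub>R a"
      have az: "a \<bullet> z = a \<bullet> x - e * norm a"
        using a(1) by (simp add: z_def inner_diff_right dot_square_norm power2_eq_square)
      have z: "z \<in> cball x e" using e a(1) by (simp add: z_def dist_norm)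
      then have "z \<in> {y. f y = 0}" using e(2) by blast
      then have "infdist z {y. f y = 0} = 0" by (rule infdist_zero)
      then have lt: "infdist z (S n) < e" using elim z by force
      obtain y where y: "y \<in> closure (S n)" "infdist z (S n) = dist z y"
        using infdist_attained[OF ne] .
      have "closure (S n) \<subseteq> {y. b \<le> a \<bullet> y}"
        using a(3) by (intro closure_minimal closed_halfspace_ge) auto
      then have "b \<le> a \<bullet> y" using y by auto
      then have "e * norm a \<le> a \<bullet> (y - z)" using az a(2) by (simp add: inner_diff_right)
      also have "\<dots> \<le> norm a * norm (y - z)" by (rule norm_cauchy_schwarz)
      finally have "e \<le> dist z y" using a(1) by (simp add: mult.commute dist_norm norm_minus_commute)
      then show False using lt y by simp
    qed
  qed
qed

section \<open>Local Hausdorff convergence\<close>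

lemma hausdorff_distance_le:
  assumes "\<And>a. a \<in> A \<Longrightarrow> \<exists>b\<in>B. dist a b \<le> e" "\<And>b. b \<in> B \<Longrightarrow> \<exists>a\<in>A. dist a b \<le> e"
  shows "hausdorff_distance A B \<le> ennreal e"
  unfolding hausdorff_distance_def
  using assms by (intro max.boundedI SUP_least) (meson INF_lower2 ennreal_leI)+

text \<open>Moving a point of \<open>A\<close> that lies within \<open>e\<close> of the ball to the ball along its ray costs at most \<open>e\<close>.\<close>

lemma near_point_in_cball:
  fixes A :: "'a::euclidean_space set"
  assumes "convex A" "0 \<in> A" "x \<in> cball 0 R" "infdist x A < e"
  shows "\<exists>y \<in> closure A \<inter> cball 0 R. dist x y \<le> 2 * e"
proof -
  have R: "R \<ge> 0" using assms(3) norm_ge_zero[of x] by (simp del: norm_ge_zero)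
  have e: "e > 0" using assms(4) infdist_nonneg[of x A] by linarith
  obtain y where y: "y \<in> closure A" "infdist x A = dist x y"
    using infdist_attained[of A x] assms(2) by blast
  define t where "t = R / (R + e)"
  have t: "0 \<le> t" "t \<le> 1" "1 - t = e / (R + e)" "t * (R + e) = R"
    using R e by (auto simp: t_def field_simps)
  have ny: "norm y \<le> R + e"
    using assms(3,4) y(2) norm_triangle_ineq2[of y x] by (simp add: dist_norm norm_minus_commute)
  have "t *\<^sub>R y + (1 - t) *\<^sub>R 0 \<in> closure A"
    using convex_closure[OF assms(1)] y(1) closure_subset[of A] assms(2) t
    by (intro convexD) auto
  moreover have "norm (t *\<^sub>R y) \<le> R"
    using mult_left_mono[OF ny t(1)] t by simp
  moreover have "dist y (t *\<^sub>R y) \<le> e"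
  proof -
    have "y - t *\<^sub>R y = (1 - t) *\<^sub>R y" by (simp add: scaleR_left_diff_distrib)
    then have "dist y (t *\<^sub>R y) = (1 - t) * norm y"
      using t(2) by (simp add: dist_norm)
    also have "\<dots> \<le> (1 - t) * (R + e)" using ny t(2) by (intro mult_left_mono) auto
    also have "\<dots> = e" using R e by (simp add: t(3))
    finally show ?thesis .
  qed
  ultimately show ?thesis
    using y assms(4) dist_triangle[of x "t *\<^sub>R y" y]
    by (intro bexI[of _ "t *\<^sub>R y"]) auto
qed

lemma local_hausdorff_convergesI:
  fixes S :: "nat \<Rightarrow> (complex ^ 'd) set"
  assumes dense: "closure (range q) = UNIV"
    and lim: "\<And>k. (\<lambda>n. infdist (q k) (S n)) \<longlonglongrightarrow> infdist (q k) A"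
    and S: "\<And>n. convex (S n)" "\<And>n. 0 \<in> S n" and A: "convex A" "0 \<in> A"
  shows "local_hausdorff_converges S A"
  unfolding local_hausdorff_converges_def
proof (intro exI[of _ 0] conjI allI impI)
  fix R :: real
  let ?d = "\<lambda>n. hausdorff_distance (closure (S n) \<inter> closure (ball 0 R)) (closure A \<inter> closure (ball 0 R))"
  show "?d \<longlonglongrightarrow> 0" if "0 \<le> R"
  proof (cases "R = 0")
    case True
    then show ?thesis by (simp add: hausdorff_distance_def bot_ennreal)
  next
    case False
    with that have R: "closure (ball 0 R) = (cball 0 R :: (complex ^ 'd) set)" by simp
    show ?thesis
    proof (rule order_tendstoI)
      fix a :: ennreal assume "0 < a"
      then obtain c where c: "0 < c" "c < a" using Orderings.dense by blast
      define e where "e = enn2real c / 2"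
      have "c < top" using c(2) top_greatest by (rule less_le_trans)
      then have ce: "c = ennreal (2 * e)" by (simp add: e_def)
      then have e: "e > 0" using c by (simp add: ennreal_zero_less_mult_iff)
      have "\<forall>\<^sub>F n in sequentially. \<forall>x\<in>cball 0 R. \<bar>infdist x (S n) - infdist x A\<bar> < e"
        using uniform_infdist_convergence[OF dense lim compact_cball e] .
      then show "\<forall>\<^sub>F n in sequentially. ?d n < a"
      proof eventually_elim
        case (elim n)
        have "?d n \<le> ennreal (2 * e)"
          unfolding R
        proof (rule hausdorff_distance_le)
          fix x assume x: "x \<in> closure (S n) \<inter> cball 0 R"
          then have "infdist x (S n) = 0" by (metis IntD1 infdist_closure infdist_zero)
          then have "infdist x A < e" using elim x by force
          then show "\<exists>b\<in>closure A \<inter> cball 0 R. dist x b \<le> 2 * e"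
            using near_point_in_cball[OF A] x by blast
        next
          fix x assume x: "x \<in> closure A \<inter> cball 0 R"
          then have "infdist x A = 0" by (metis IntD1 infdist_closure infdist_zero)
          then have "infdist x (S n) < e" using elim x by force
          then show "\<exists>b\<in>closure (S n) \<inter> cball 0 R. dist b x \<le> 2 * e"
            using near_point_in_cball[OF S] x by (metis IntD2 dist_commute)
        qed
        then show ?case using ce c by auto
      qed
    qed auto
  qed
qed simp

section \<open>The class \<open>K_set r\<close> is closed under limits\<close>

lemma direction_in_open_convex:
  fixes A :: "'a::real_normed_vector set"
  assumes "open A" "convex A" "0 \<in> A" and line: "\<And>t::real. a + t *\<^sub>R b \<in> A"
  shows "b \<in> A"
proof -
  have "(\<lambda>n. (- inverse (real (Suc n))) *\<^sub>R a) \<longlonglongrightarrow> (- 0) *\<^sub>R a"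
    by (intro tendsto_intros LIMSEQ_inverse_real_of_nat)
  then have "\<forall>\<^sub>F n in sequentially. (- inverse (real (Suc n))) *\<^sub>R a \<in> A"
    using assms by (auto dest: topological_tendstoD)
  then obtain n where n: "(- inverse (real (Suc n))) *\<^sub>R a \<in> A"
    using eventually_happens'[OF sequentially_bot] by blast
  define t where "t = real (Suc n) + 1"
  have t: "(- 1 / (t - 1)) *\<^sub>R a \<in> A" "t > 1"
    using n by (simp_all add: t_def inverse_eq_divide)
  have "(1 / t) *\<^sub>R (a + t *\<^sub>R b) + (1 - 1 / t) *\<^sub>R ((- 1 / (t - 1)) *\<^sub>R a) \<in> A"
    using t by (intro convexD[OF assms(2)] line) auto
  moreover have "(1 - 1 / t) * (- 1 / (t - 1)) = - (1 / t)"
    using t(2) by (simp add: divide_simps)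
  then have "(1 / t) *\<^sub>R (a + t *\<^sub>R b) + (1 - 1 / t) *\<^sub>R ((- 1 / (t - 1)) *\<^sub>R a) = b"
    using t(2) by (simp only: scaleR_add_right scaleR_scaleR) simp
  ultimately show ?thesis by simp
qed

lemma vec_sum_std_basis: "x = (\<Sum>j\<in>UNIV. (x $ j) *s std_basis j)"
  by (simp add: vec_eq_iff std_basis_def axis_def if_distrib cong: if_cong)

lemma C_properly_convexI:
  fixes A :: "(complex ^ 'd::{finite,linorder}) set"
  assumes A: "open A" "convex A" "0 \<in> A"
    and disj: "\<And>j. (\<lambda>v. std_basis j + v) ` vec.span {std_basis k | k. j < k} \<inter> A = {}"
  shows "C_properly_convex A"
  unfolding C_properly_convex_def complex_affine_line_def
proof (intro conjI A notI, elim exE conjE)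
  fix L a b
  assume L: "L \<subseteq> A" "b \<noteq> 0" "L = range (\<lambda>z. a + z *s b)"
  define j where "j = Min {k. b $ k \<noteq> 0}"
  have ne: "{k. b $ k \<noteq> 0} \<noteq> {}" using L(2) by (auto simp: vec_eq_iff)
  then have bj: "b $ j \<noteq> 0" using Min_in[of "{k. b $ k \<noteq> 0}"] by (simp add: j_def)
  have below: "b $ k = 0" if "k < j" for k
    using that Min_le[of "{k. b $ k \<noteq> 0}" k] unfolding j_def[symmetric] by fastforce
  define c where "c = inverse (b $ j) *s b"
  have cj: "c $ j = 1" using bj by (simp add: c_def)
  have ck: "c $ k = 0" if "k < j" for k using below[OF that] by (simp add: c_def)
  have "c \<in> A"
  proof (rule direction_in_open_convex[OF A])
    fix t :: real
    have "t *\<^sub>R c = (of_real t * inverse (b $ j)) *s b"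
      unfolding c_def vec_eq_iff vector_scaleR_component vector_smult_component
      by (simp add: scaleR_conv_of_real mult.assoc)
    then show "a + t *\<^sub>R c \<in> A" using L by auto
  qed
  moreover have "c - std_basis j \<in> vec.span {std_basis k | k. j < k}"
  proof -
    have "c - std_basis j = (\<Sum>k\<in>{k. j < k}. (c $ k) *s std_basis k)"
    proof (subst vec_eq_iff, rule allI)
      fix i
      have "(\<Sum>k\<in>{k. j < k}. (c $ k) *s std_basis k) $ i = (\<Sum>k\<in>{k. j < k}. if k = i then c $ k else 0)"
        unfolding sum_component by (intro sum.cong) (auto simp: std_basis_def axis_def)
      also have "\<dots> = (if j < i then c $ i else 0)"
        by simp
      also have "\<dots> = (c - std_basis j) $ i"
        using cj ck[of i] by (cases j i rule: linorder_cases) (auto simp: std_basis_def axis_def)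
      finally show "(c - std_basis j) $ i = (\<Sum>k\<in>{k. j < k}. (c $ k) *s std_basis k) $ i" by simp
    qed
    also have "\<dots> \<in> vec.span {std_basis k | k. j < k}"
      by (intro vec.span_sum vec.span_scale vec.span_base) auto
    finally show ?thesis .
  qed
  then have "c \<in> (\<lambda>v. std_basis j + v) ` vec.span {std_basis k | k. j < k}"
    by (intro image_eqI[of _ _ "c - std_basis j"]) auto
  ultimately show False using disj[of j] by blast
qed

definition polydisc_radius :: "real \<Rightarrow> 'd::{finite,linorder} \<Rightarrow> real" where
  "polydisc_radius r j = (if j = Min UNIV then r else 1)"

definition cross_body :: "real \<Rightarrow> (complex ^ 'd::{finite,linorder}) set" where
  "cross_body r = {x. (\<Sum>j\<in>UNIV. norm (x $ j) / polydisc_radius r j) < 1}"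

lemma polydisc_radius_pos: "0 < r \<Longrightarrow> 0 < polydisc_radius r j"
  by (simp add: polydisc_radius_def)

lemma open_cross_body: "open (cross_body r)"
  unfolding cross_body_def divide_inverse by (intro open_Collect_less continuous_intros)

lemma zero_in_cross_body: "0 \<in> cross_body r"
  by (simp add: cross_body_def)

lemma scaled_basis_in_cross_body:
  assumes "0 < r" "norm z < polydisc_radius r j"
  shows "z *s std_basis j \<in> cross_body r"
proof -
  have "(\<Sum>i\<in>UNIV. norm ((z *s std_basis j) $ i) / polydisc_radius r i)
      = (\<Sum>i\<in>UNIV. if i = j then norm z / polydisc_radius r j else 0)"
    by (intro sum.cong) (auto simp: std_basis_def axis_def)
  then show ?thesis using assms by (simp add: cross_body_def polydisc_radius_pos)
qed

lemma K_set_cross_body: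
  fixes A :: "(complex ^ 'd::{finite,linorder}) set"
  assumes "0 < r" and A: "A \<in> K_set r"
  shows "cross_body r \<subseteq> A"
proof
  have conv: "convex A" using A by (auto simp: K_set_def X_space_def C_properly_convex_def)
  have 1: "(of_real r * z) *s std_basis (Min UNIV) \<in> A" if "norm z < 1" for z
    using A that by (auto simp: K_set_def)
  have 2: "z *s std_basis j \<in> A" if "norm z < 1" "j \<noteq> Min UNIV" for z j
    using A that by (auto simp: K_set_def)
  have sub: "(of_real (polydisc_radius r j) * z) *s std_basis j \<in> A" if "norm z < 1" for z j
    using 1[OF that] 2[OF that, of j] by (auto simp: polydisc_radius_def)
  fix x :: "complex ^ 'd::{finite,linorder}" assume x: "x \<in> cross_body r"
  define s where "s = (\<Sum>j\<in>UNIV. norm (x $ j) / polydisc_radius r j)"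
  have nn: "norm (x $ j) / polydisc_radius r j \<ge> 0" for j
    using polydisc_radius_pos[OF assms(1), of j] by simp
  have s1: "s < 1" using x by (simp add: cross_body_def s_def)
  show "x \<in> A"
  proof (cases "s = 0")
    case True
    then have "norm (x $ j) / polydisc_radius r j = 0" for j
      using nn by (simp add: s_def sum_nonneg_eq_0_iff)
    then have "x $ j = 0" for j
      using polydisc_radius_pos[OF assms(1), of j] by (metis divide_eq_0_iff less_irrefl norm_eq_zero)
    then have "x = 0" by (simp add: vec_eq_iff)
    then show ?thesis using 1[of 0] by simp
  next
    case False
    then have s0: "s > 0" using sum_nonneg[of UNIV, OF nn] by (simp add: s_def less_le)
    define y where "y j = (of_real (polydisc_radius r j) * (of_real s * sgn (x $ j))) *s std_basis j" for j
    define l where "l j = norm (x $ j) / polydisc_radius r j / s" for j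
    have "(\<Sum>j\<in>UNIV. l j *\<^sub>R y j) \<in> A"
    proof (rule convex_sum[OF _ conv])
      have "(\<Sum>j\<in>UNIV. l j) = s / s"
        unfolding l_def sum_divide_distrib[symmetric] by (simp only: s_def)
      then show "(\<Sum>j\<in>UNIV. l j) = 1" using s0 by simp
      show "l j \<ge> 0" for j using divide_nonneg_pos[OF nn s0] unfolding l_def .
      show "y j \<in> A" for j
        unfolding y_def using s0 s1 by (intro sub) (simp add: norm_mult norm_sgn)
    qed simp
    also have "l j *\<^sub>R y j = (x $ j) *s std_basis j" for j
    proof -
      have "l j * (polydisc_radius r j * s) = norm (x $ j)"
        using s0 polydisc_radius_pos[OF assms(1), of j] by (simp add: l_def)
      then have "of_real (l j) * (of_real (polydisc_radius r j) * (of_real s * sgn (x $ j)))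
          = of_real (norm (x $ j)) * sgn (x $ j)"
        by (simp only: mult.assoc[symmetric] of_real_mult[symmetric])
      also have "\<dots> = x $ j" by (cases "x $ j = 0") (simp_all add: sgn_eq)
      finally show ?thesis
        unfolding y_def vec_eq_iff vector_scaleR_component vector_smult_component
        by (simp add: scaleR_conv_of_real mult.assoc[symmetric])
    qed
    then have "(\<Sum>j\<in>UNIV. l j *\<^sub>R y j) = x" using vec_sum_std_basis[of x] by simp
    finally show ?thesis .
  qed
qed

lemma K_set_limit:
  fixes S :: "nat \<Rightarrow> (complex ^ 'd::{finite,linorder}) set"
  assumes "0 < r" and S: "\<And>n. S n \<in> K_set r"
    and lim: "\<And>x. (\<lambda>n. infdist x (S n)) \<longlonglongrightarrow> f x"
  obtains A where "A \<in> K_set r" "\<And>x. infdist x A = f x"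
proof -
  have conv: "convex (S n)" and ne: "S n \<noteq> {}" for n
    using S[of n] by (auto simp: K_set_def X_space_def C_properly_convex_def)
  define C where "C = {y. f y = 0}"
  have clC: "closed C" and fC: "\<And>x. f x = infdist x C"
    unfolding C_def by (rule infdist_limit_zero_set[OF lim ne])+
  have convC: "convex C" unfolding C_def by (rule infdist_limit_zero_set_convex[OF lim conv])
  have limC: "x \<in> C" if "\<And>n. x \<in> closure (S n)" for x
  proof -
    have "infdist x (S n) = 0" for n using that[of n] by (metis infdist_closure infdist_zero)
    then show ?thesis using lim[of x] LIMSEQ_unique[OF _ tendsto_const] by (auto simp: C_def)
  qed
  define A where "A = interior C"
  have crossS: "cross_body r \<subseteq> S n" for n by (rule K_set_cross_body[OF assms(1) S])
  have "cross_body r \<subseteq> C" using limC crossS closure_subset by blast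
  then have cross: "cross_body r \<subseteq> A"
    unfolding A_def by (intro interior_maximal open_cross_body)
  have A0: "0 \<in> A" using cross zero_in_cross_body by blast
  have opA: "open A" and cA: "convex A" by (auto simp: A_def convC)
  have clA: "closure A = C"
    using convex_closure_interior[OF convC] A0 clC by (auto simp: A_def)
  have disj: "(\<lambda>v. std_basis j + v) ` vec.span {std_basis k | k. j < k} \<inter> A = {}" for j
  proof (rule equals0I)
    fix x assume x: "x \<in> (\<lambda>v. std_basis j + v) ` vec.span {std_basis k | k. j < k} \<inter> A"
    have "\<forall>\<^sub>F n in sequentially. x \<in> S n"
      by (rule interior_limit_eventually_in[OF lim conv ne]) (use x in \<open>simp add: A_def C_def\<close>)
    then obtain n where "x \<in> S n" using eventually_happens'[OF sequentially_bot] by blast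
    then show False using x S[of n] unfolding K_set_def by blast
  qed
  have "A \<in> X_space"
    using opA A0 C_properly_convexI[OF opA cA A0 disj] by (auto simp: X_space_def)
  moreover have "{(of_real r * z) *s std_basis (Min UNIV) | z. z \<in> ball 0 1} \<subseteq> A"
    using cross scaled_basis_in_cross_body[OF assms(1)] assms(1)
    by (force simp: norm_mult polydisc_radius_def)
  moreover have "{z *s std_basis j | z. z \<in> ball 0 1} \<subseteq> A" if "j \<noteq> Min UNIV" for j
    using cross scaled_basis_in_cross_body[OF assms(1)] that
    by (force simp: polydisc_radius_def)
  moreover have "std_basis j \<in> frontier A" for j
  proof -
    have "std_basis j \<in> closure (S n)" for n
      using S[of n] by (auto simp: K_set_def frontier_def)
    then have "std_basis j \<in> closure A" using limC clA by blast
    moreover have "std_basis j \<notin> A"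
      using disj[of j] vec.span_zero by (force simp: image_iff)
    ultimately show ?thesis using opA by (simp add: frontier_def interior_open)
  qed
  ultimately have "A \<in> K_set r" using disj by (simp add: K_set_def)
  moreover have "infdist x A = f x" for x using fC clA by (metis infdist_closure)
  ultimately show ?thesis using that by blast
qed

section \<open>Compactness\<close>

lemma tendsto_fun_iff:
  fixes l :: "'i \<Rightarrow> 'b::topological_space"
  shows "(f \<longlongrightarrow> l) F \<longleftrightarrow> (\<forall>i. ((\<lambda>c. f c i) \<longlongrightarrow> l i) F)"
  unfolding limitin_canonical_iff[symmetric] euclidean_product_topology[symmetric]
    limitin_componentwise by simp

lemma compact_box_fun:
  fixes B :: "'i \<Rightarrow> 'b::topological_space set"
  assumes "\<And>i. compact (B i)"
  shows "compact (PiE UNIV B)"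
  unfolding compactin_euclidean_iff[symmetric] euclidean_product_topology[symmetric]
    compactin_PiE using assms by simp

definition dist_code :: "(nat \<Rightarrow> 'a::metric_space) \<Rightarrow> 'a set \<Rightarrow> nat \<Rightarrow> real" where
  "dist_code q A = (\<lambda>k. infdist (q k) A)"

lemma compact_dist_code_K_set:
  fixes q :: "nat \<Rightarrow> complex ^ 'd::{finite,linorder}"
  assumes "0 < r" and dense: "closure (range q) = UNIV"
  shows "compact (dist_code q ` K_set r)"
proof -
  have "dist_code q ` K_set r \<subseteq> PiE UNIV (\<lambda>k. {0..norm (q k)})"
  proof (intro image_subsetI PiE_I)
    fix A :: "(complex ^ 'd::{finite,linorder}) set" and k assume "A \<in> K_set r"
    then have "0 \<in> A" using K_set_cross_body[OF assms(1)] zero_in_cross_body by blast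
    then show "dist_code q A k \<in> {0..norm (q k)}"
      using infdist_le[of 0 A "q k"] by (simp add: dist_code_def infdist_nonneg)
  qed simp
  moreover have "compact (PiE UNIV (\<lambda>k. {0..norm (q k)}))" by (intro compact_box_fun) simp
  moreover have "closed (dist_code q ` K_set r)"
    unfolding closed_sequential_limits
  proof (intro allI impI, elim conjE)
    fix X and l :: "nat \<Rightarrow> real"
    assume X: "\<forall>n. X n \<in> dist_code q ` K_set r" "X \<longlonglongrightarrow> l"
    then obtain S where S: "\<And>n. S n \<in> K_set r" "\<And>n. X n = dist_code q (S n)"
      unfolding image_iff by metis
    have l: "(\<lambda>n. infdist (q k) (S n)) \<longlonglongrightarrow> l k" for k
      using X(2) by (auto simp: tendsto_fun_iff S(2) dist_code_def)
    have "convergent (\<lambda>n. infdist x (S n))" for x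
      by (rule infdist_convergent_from_dense[OF dense convergentI[OF l]])
    then have lim: "(\<lambda>n. infdist x (S n)) \<longlonglongrightarrow> lim (\<lambda>n. infdist x (S n))" for x
      by (simp add: convergent_LIMSEQ_iff)
    obtain A where A: "A \<in> K_set r" "\<And>x. infdist x A = lim (\<lambda>n. infdist x (S n))"
      by (rule K_set_limit[OF assms(1) S(1) lim]) (rule that)
    have "l k = infdist (q k) A" for k
      unfolding A(2) by (rule LIMSEQ_unique[OF l lim])
    then have "l = dist_code q A" by (simp add: dist_code_def fun_eq_iff)
    then show "l \<in> dist_code q ` K_set r" using A(1) by blast
  qed
  ultimately show ?thesis by (metis compact_Int_closed inf.absorb_iff2)
qed

lemma local_hausdorff_open_separated:
  fixes q :: "nat \<Rightarrow> complex ^ 'd::{finite,linorder}"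
  assumes "0 < r" and dense: "closure (range q) = UNIV"
    and U: "local_hausdorff_open U" and A: "A \<in> K_set r \<inter> U"
  shows "dist_code q A \<notin> closure (dist_code q ` (K_set r - U))"
proof
  assume "dist_code q A \<in> closure (dist_code q ` (K_set r - U))"
  then obtain X where X: "\<And>n. X n \<in> dist_code q ` (K_set r - U)" "X \<longlonglongrightarrow> dist_code q A"
    unfolding closure_sequential by blast
  then obtain S where S: "\<And>n. S n \<in> K_set r - U" "\<And>n. X n = dist_code q (S n)"
    unfolding image_iff by metis
  have K: "convex B" "0 \<in> B" "B \<in> X_space" if "B \<in> K_set r" for B :: "(complex ^ 'd::{finite,linorder}) set"
    using that K_set_cross_body[OF assms(1) that] zero_in_cross_body
    by (auto simp: K_set_def X_space_def C_properly_convex_def)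
  have "local_hausdorff_converges S A"
  proof (rule local_hausdorff_convergesI[OF dense])
    show "(\<lambda>n. infdist (q k) (S n)) \<longlonglongrightarrow> infdist (q k) A" for k
      using X(2) by (auto simp: tendsto_fun_iff S(2) dist_code_def)
  qed (use S A K in auto)
  then have "\<forall>\<^sub>F n in sequentially. S n \<in> U"
    using U A S K unfolding local_hausdorff_open_def by blast
  then show False using S eventually_happens'[OF sequentially_bot] by blast
qed

theorem proposition4p2:
  fixes r :: real
  assumes "0 < r" and "r \<le> 1"
  shows "compactin local_hausdorff_topology (K_set r :: (complex ^ 'd::{finite,linorder}) set set)"
  unfolding compactin_def topspace_local_hausdorff_topology openin_local_hausdorff_topology
proof (intro conjI allI impI)
  show "(K_set r :: (complex ^ 'd::{finite,linorder}) set set) \<subseteq> X_space" by (auto simp: K_set_def)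
next
  fix \<U> :: "(complex ^ 'd::{finite,linorder}) set set set"
  assume \<U>: "Ball \<U> local_hausdorff_open \<and> K_set r \<subseteq> \<Union>\<U>"
  obtain q :: "nat \<Rightarrow> complex ^ 'd::{finite,linorder}" where q: "closure (range q) = UNIV" by (rule ex_dense_sequence)
  let ?V = "\<lambda>U. - closure (dist_code q ` (K_set r - U))"
  have "dist_code q ` K_set r \<subseteq> (\<Union>U\<in>\<U>. ?V U)"
    using local_hausdorff_open_separated[OF assms(1) q] \<U> by blast
  then obtain \<F> where \<F>: "\<F> \<subseteq> \<U>" "finite \<F>" "dist_code q ` K_set r \<subseteq> (\<Union>U\<in>\<F>. ?V U)"
    using compactE_image[OF compact_dist_code_K_set[OF assms(1) q], of \<U> ?V]
    by (metis (no_types, lifting) closed_closure open_Compl)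
  have "K_set r \<subseteq> \<Union>\<F>"
  proof
    fix A :: "(complex ^ 'd::{finite,linorder}) set" assume A: "A \<in> K_set r"
    then obtain U where U: "U \<in> \<F>" "dist_code q A \<in> ?V U" using \<F>(3) by blast
    then have "dist_code q A \<notin> dist_code q ` (K_set r - U)" by (meson ComplD closure_subset subsetD)
    then show "A \<in> \<Union>\<F>" using A U(1) by blast
  qed
  then show "\<exists>\<F>. finite \<F> \<and> \<F> \<subseteq> \<U> \<and> K_set r \<subseteq> \<Union>\<F>" using \<F> by blast
qed

end
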